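(* Let $f:\mathbb{R}^n\to\mathbb{R}$ be bounded below and continuously differentiable with $\nabla f$ Lipschitz with constant $L_{\nabla f}$, and let $\tilde f$ satisfy $|\tilde f(z)-f(z)|\le\epsilon_f$ for all $z$, for some $\epsilon_f>0$. Let $x\in\mathbb{R}^n$, $\Delta>0$, points $y_1,\ldots,y_p$ with $\|y_i-x\|\le\beta\Delta$ for some $\beta>0$ and all $i$, with $\hat F$ invertible, and let $m(y)=c+g^T(y-x)+\tfrac12(y-x)^TH(y-x)$ be the minimum Frobenius norm quadratic interpolant to the values $\tilde f(y_1),\ldots,\tilde f(y_p)$ (see context). Then $\|H\|\le\kappa_H:=\frac{L_{\nabla f}}{2}p\beta^4\|\hat F^{-1}\|_\infty+\frac{\epsilon_f}{\Delta^2}p\beta^2\|\hat F^{-1}\|_\infty$, and for all $y\in B(x,\Delta)$, $$|m(y)-f(y)|\le\kappa_{\mathrm{mf}}\Delta^2+\tilde\kappa_{\mathrm{mf}}\epsilon_f,\qquad\|\nabla m(y)-\nabla f(y)\|\le\kappa_{\mathrm{mg}}\Delta+\tilde\kappa_{\mathrm{mg}}\frac{\epsilon_f}{\Delta},$$ where $\kappa_{\mathrm{mf}}=\frac{L_{\nabla f}+\kappa_H}{2}(1+\sqrt n)\beta^2\|\hat M^\dagger\|_\infty+\frac{L_{\nabla f}+\kappa_H}{2}$, $\tilde\kappa_{\mathrm{mf}}=(1+\sqrt n)\|\hat M^\dagger\|_\infty$, $\kappa_{\mathrm{mg}}=2\kappa_{\mathrm{mf}}+2\kappa_H$ and $\t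ilde\kappa_{\mathrm{mg}}=2\tilde\kappa_{\mathrm{mf}}$.
   Context: Here $n+2\le p\le(n+1)(n+2)/2-1$. Let $\hat s_i=(y_i-x)/\Delta$, $\hat M\in\mathbb{R}^{p\times(n+1)}$ with rows $[1,\hat s_i^T]$ and Moore–Penrose pseudoinverse $\hat M^\dagger$, $\hat P_{ij}=\tfrac12(\hat s_i^T\hat s_j)^2$, $\hat F=\begin{bmatrix}\hat P&\hat M\\ \hat M^T&0\end{bmatrix}$. The minimum Frobenius norm interpolant to values $v_1,\ldots,v_p$ is $q(y)=c+g^T(y-x)+\tfrac12(y-x)^TH(y-x)$ with $H$ symmetric minimizing $\tfrac14\|H\|_F^2$ subject to $q(y_i)=v_i$; when $\hat F$ is invertible it is obtained by solving $\hat F[\hat\lambda;c;\Delta g]=[v;0;0_n]$ and $H=\sum_i(\hat\lambda_i/\Delta^4)(y_i-x)(y_i-x)^T$. $\|A\|_\infty$ is the maximum absolute row sum; $B(x,\Delta)=\{y:\|y-x\|\le\Delta\}$. *)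

theory Defs
  imports "HOL-Analysis.Analysis"
begin

text \<open>Quadratic model q(z) = c + g^T (z-x) + 1/2 (z-x)^T H (z-x).\<close>
definition qval :: "real \<Rightarrow> real^'n \<Rightarrow> real^'n^'n \<Rightarrow> real^'n \<Rightarrow> real^'n \<Rightarrow> real" where
  "qval c g H x z = c + inner g (z - x) + 1/2 * inner (z - x) (H *v (z - x))"

text \<open>Minimum Frobenius norm interpolant: H symmetric, interpolation conditions,
  and H minimises (1/4) ||H||_F^2 (the norm on real^'n^'n is the Frobenius norm)
  among all symmetric interpolating quadratics.\<close>
definition is_mfn_interp ::
  "real^'n \<Rightarrow> ('p::finite \<Rightarrow> real^'n) \<Rightarrow> ('p \<Rightarrow> real) \<Rightarrow> real \<Rightarrow> real^'n \<Rightarrow> real^'n^'n \<Rightarrow> bool" where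
  "is_mfn_interp x y v c g H \<longleftrightarrow>
     transpose H = H \<and> (\<forall>i. qval c g H x (y i) = v i) \<and>
     (\<forall>c' g' H'. transpose H' = H' \<and> (\<forall>i. qval c' g' H' x (y i) = v i)
        \<longrightarrow> (1/4) * (norm H)^2 \<le> (1/4) * (norm H')^2)"

text \<open>Scaled points s_i = (y_i - x)/Delta.\<close>
definition shat :: "real^'n \<Rightarrow> real \<Rightarrow> ('p \<Rightarrow> real^'n) \<Rightarrow> 'p \<Rightarrow> real^'n" where
  "shat x \<Delta> y i = (y i - x) /\<^sub>R \<Delta>"

text \<open>M-hat: rows [1, s_i^T]; the column index Inl () is the constant column.\<close>
definition Mhat :: "real^'n \<Rightarrow> real \<Rightarrow> ('p::finite \<Rightarrow> real^'n) \<Rightarrow> real^(unit + 'n)^'p" where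
  "Mhat x \<Delta> y = (\<chi> i k. case k of Inl _ \<Rightarrow> 1 | Inr j \<Rightarrow> shat x \<Delta> y i $ j)"

definition Phat :: "real^'n \<Rightarrow> real \<Rightarrow> ('p::finite \<Rightarrow> real^'n) \<Rightarrow> real^'p^'p" where
  "Phat x \<Delta> y = (\<chi> i j. 1/2 * (inner (shat x \<Delta> y i) (shat x \<Delta> y j))^2)"

text \<open>F-hat = [[P, M],[M^T, 0]].\<close>
definition Fhat :: "real^'n \<Rightarrow> real \<Rightarrow> ('p::finite \<Rightarrow> real^'n)
    \<Rightarrow> real^('p + (unit + 'n))^('p + (unit + 'n))" where
  "Fhat x \<Delta> y = (\<chi> a b. case a of
      Inl i \<Rightarrow> (case b of Inl j \<Rightarrow> Phat x \<Delta> y $ i $ j | Inr k \<Rightarrow> Mhat x \<Delta> y $ i $ k)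
    | Inr k \<Rightarrow> (case b of Inl j \<Rightarrow> Mhat x \<Delta> y $ j $ k | Inr _ \<Rightarrow> 0))"

text \<open>Moore-Penrose pseudoinverse, via the four Penrose conditions.\<close>
definition pinv :: "real^'m^'k \<Rightarrow> real^'k^'m" where
  "pinv A = (THE B. A ** B ** A = A \<and> B ** A ** B = B \<and>
       transpose (A ** B) = A ** B \<and> transpose (B ** A) = B ** A)"

text \<open>Infinity norm: maximum absolute row sum.\<close>
definition inf_norm :: "real^'m^'k \<Rightarrow> real" where
  "inf_norm A = Max (range (\<lambda>i. \<Sum>j\<in>UNIV. \<bar>A $ i $ j\<bar>))"

end

theory Submission
  imports Defs
begin

(* The minimum Frobenius norm Hessian does not change when an affine function is subtracted from
   the data, and it is read off the solution of the F-hat system.  Subtracting the first-order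
   Taylor polynomial of f at x leaves data of size L/2 (beta Delta)^2 + eps_f, so the multipliers,
   and with them H, are bounded through the infinity norm of the inverse of F-hat.  Once H is
   bounded, the interpolation conditions say that M-hat maps the affine errors
   (c - f x, Delta (g - grad f x)) to residuals of size eps_f + (L + kappa_H)/2 (beta Delta)^2;
   invertibility of F-hat makes M-hat injective, so its pseudoinverse is a left inverse and bounds
   these errors.  Taylor's theorem for a Lipschitz gradient then spreads them over the ball. *)

lemma has_real_derivative_along_line:
  fixes f :: "'a::real_inner \<Rightarrow> real"
  assumes "GDERIV f (u + t *\<^sub>R d) :> G"
  shows "((\<lambda>t. f (u + t *\<^sub>R d)) has_real_derivative inner d G) (at t)"
proof -
  have "((\<lambda>t. u + t *\<^sub>R d) has_derivative (\<lambda>h. h *\<^sub>R d)) (at t)"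
    by (auto intro!: derivative_eq_intros)
  from has_derivative_compose[OF this assms[unfolded gderiv_def]]
  have "((\<lambda>t. f (u + t *\<^sub>R d)) has_derivative (\<lambda>h. inner (h *\<^sub>R d) G)) (at t)"
    by (simp add: o_def)
  then show ?thesis
    by (simp add: has_field_derivative_def mult_commute_abs inner_commute[of d])
qed

lemma lipschitz_gradient_taylor_bound:
  fixes f :: "'a::real_inner \<Rightarrow> real"
  assumes grad: "\<And>z. GDERIV f z :> gf z" and lip: "L-lipschitz_on UNIV gf"
  shows "\<bar>f w - f u - inner (gf u) (w - u)\<bar> \<le> L / 2 * norm (w - u)^2"
proof -
  define d where "d = w - u"
  have slope: "\<bar>inner d (gf (u + t *\<^sub>R d)) - inner (gf u) d\<bar> \<le> L * t * norm d ^ 2"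
    if "0 \<le> t" for t
  proof -
    have "\<bar>inner d (gf (u + t *\<^sub>R d)) - inner (gf u) d\<bar> = \<bar>inner d (gf (u + t *\<^sub>R d) - gf u)\<bar>"
      by (simp add: inner_diff_right inner_commute)
    also have "\<dots> \<le> norm d * norm (gf (u + t *\<^sub>R d) - gf u)"
      by (rule Cauchy_Schwarz_ineq2)
    also have "\<dots> \<le> norm d * (L * norm (t *\<^sub>R d))"
      using lipschitz_onD[OF lip, of "u + t *\<^sub>R d" u] by (simp add: dist_norm mult_left_mono)
    also have "\<dots> = L * t * norm d ^ 2"
      using that by (simp add: power2_eq_square)
    finally show ?thesis .
  qed
  have signed: "s * (f w - f u - inner (gf u) d) \<le> L / 2 * norm d ^ 2" if "\<bar>s\<bar> = 1" for s
  proof -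
    define \<phi> where "\<phi> t = s * (f (u + t *\<^sub>R d) - t * inner (gf u) d) - L / 2 * t^2 * norm d ^ 2" for t
    have "DERIV \<phi> t :> s * (inner d (gf (u + t *\<^sub>R d)) - inner (gf u) d) - L * t * norm d ^ 2" for t
      unfolding \<phi>_def by (auto intro!: derivative_eq_intros has_real_derivative_along_line grad)
    moreover have "s * (inner d (gf (u + t *\<^sub>R d)) - inner (gf u) d) \<le> L * t * norm d ^ 2"
      if "0 \<le> t" for t
      using slope[OF that] \<open>\<bar>s\<bar> = 1\<close> abs_le_D1 abs_mult by (metis mult_1)
    ultimately have "\<phi> 1 \<le> \<phi> 0"
      by (intro DERIV_nonpos_imp_nonincreasing[of 0 1]) force+
    then show ?thesis
      by (simp add: \<phi>_def d_def algebra_simps)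
  qed
  show ?thesis
    using signed[of 1] signed[of "-1"] unfolding d_def abs_le_iff by simp
qed

lemma abs_quadratic_form_le_onorm:
  fixes A :: "real^'n^'n"
  shows "\<bar>inner v (A *v v)\<bar> \<le> onorm ((*v) A) * norm v ^ 2"
proof -
  have "\<bar>inner v (A *v v)\<bar> \<le> norm v * norm (A *v v)"
    by (rule Cauchy_Schwarz_ineq2)
  also have "\<dots> \<le> norm v * (onorm ((*v) A) * norm v)"
    by (intro mult_left_mono onorm) auto
  finally show ?thesis
    by (simp add: power2_eq_square mult_ac)
qed

lemma lipschitz_gradient_quadratic_bound:
  fixes f :: "real^'n \<Rightarrow> real" and H :: "real^'n^'n"
  assumes grad: "\<And>z. GDERIV f z :> gf z" and lip: "L-lipschitz_on UNIV gf"
    and H: "onorm ((*v) H) \<le> \<kappa>" and r: "norm (w - u) \<le> r"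
  shows "\<bar>f w - f u - inner (gf u) (w - u) - 1/2 * inner (w - u) (H *v (w - u))\<bar> \<le> (L + \<kappa>) / 2 * r^2"
proof -
  have "norm (w - u)^2 \<le> r^2"
    using r by (simp add: power_mono)
  then have "L / 2 * norm (w - u)^2 \<le> L / 2 * r^2"
    using lipschitz_on_nonneg[OF lip] by (simp add: mult_left_mono)
  then have "\<bar>f w - f u - inner (gf u) (w - u)\<bar> \<le> L / 2 * r^2"
    using lipschitz_gradient_taylor_bound[OF grad lip, of w u] by linarith
  moreover have "\<bar>inner (w - u) (H *v (w - u))\<bar> \<le> \<kappa> * r^2"
    using abs_quadratic_form_le_onorm[of "w - u" H] H \<open>norm (w - u)^2 \<le> r^2\<close>
    by (meson mult_mono onorm_pos_le matrix_vector_mul_bounded_linear order_trans zero_le_power2)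
  ultimately show ?thesis
    unfolding abs_le_iff add_divide_distrib distrib_right by linarith
qed

definition penrose :: "real^'m^'k \<Rightarrow> real^'k^'m \<Rightarrow> bool" where
  "penrose A B \<longleftrightarrow> A ** B ** A = A \<and> B ** A ** B = B \<and>
     transpose (A ** B) = A ** B \<and> transpose (B ** A) = B ** A"

lemma pinv_eq_The_penrose: "pinv A = (THE B. penrose A B)"
  by (simp add: pinv_def penrose_def)

lemma penrose_left_inverse:
  fixes M :: "real^'m^'k"
  assumes inj: "inj ((*v) M)" and "penrose M B"
  shows "B ** M = mat 1"
proof (rule matrix_eq[THEN iffD2], intro allI)
  fix v
  have "M *v ((B ** M) *v v) = M *v v"
    using \<open>penrose M B\<close> by (metis penrose_def matrix_vector_mul_assoc)
  then show "(B ** M) *v v = mat 1 *v v"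
    using inj by (simp add: inj_eq)
qed

lemma penrose_unique:
  fixes M :: "real^'m^'k"
  assumes inj: "inj ((*v) M)" and B: "penrose M B" and C: "penrose M C"
  shows "B = C"
proof -
  have BM: "B ** M = mat 1"
    using penrose_left_inverse[OF inj B] .
  have sB: "transpose (M ** B) = M ** B" and sC: "transpose (M ** C) = M ** C"
    and MCM: "M ** C ** M = M"
    using B C by (auto simp: penrose_def)
  have "transpose (M ** B) ** transpose (M ** C) = transpose (M ** C ** (M ** B))"
    by (simp only: matrix_transpose_mul)
  also have "M ** C ** (M ** B) = M ** B"
    by (simp add: matrix_mul_assoc MCM)
  finally have MB: "M ** B = M ** B ** (M ** C)"
    using sB sC by simp
  have "B = B ** (M ** B)"
    using BM by (simp add: matrix_mul_assoc)
  also have "\<dots> = (B ** M) ** (B ** M) ** C"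
    by (subst MB) (simp add: matrix_mul_assoc)
  also have "\<dots> = C"
    using BM by simp
  finally show ?thesis .
qed

lemma ex_penrose_of_inj:
  fixes M :: "real^'m^'k"
  assumes inj: "inj ((*v) M)"
  shows "\<exists>B. penrose M B"
proof -
  define G where "G = transpose M ** M"
  have "inj ((*v) G)"
  proof (rule linear_injective_0[THEN iffD2, rule_format])
    fix z assume "G *v z = 0"
    moreover have "inner z (G *v z) = inner (M *v z) (M *v z)"
      unfolding G_def matrix_vector_mul_assoc[symmetric] transpose_matrix_vector
      by (metis dot_lmul_matrix inner_commute)
    ultimately have "M *v z = M *v 0"
      by simp
    then show "z = 0"
      by (rule injD[OF inj])
  qed simp
  then obtain Gi where Gi: "Gi ** G = mat 1"
    using matrix_left_invertible_injective by blast
  then have GGi: "G ** Gi = mat 1"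
    using matrix_left_right_inverse by blast
  have "transpose G = G"
    unfolding G_def by (simp add: matrix_transpose_mul)
  then have "transpose Gi ** G = mat 1"
    using arg_cong[OF GGi, of transpose] by (simp add: matrix_transpose_mul)
  then have GiT: "transpose Gi = Gi"
    by (metis GGi matrix_mul_assoc matrix_mul_lid matrix_mul_rid)
  have "Gi ** transpose M ** M = mat 1"
    using Gi by (simp add: G_def matrix_mul_assoc)
  then have "penrose M (Gi ** transpose M)"
    unfolding penrose_def
    by (simp add: matrix_mul_assoc[symmetric] matrix_transpose_mul GiT)
  then show ?thesis ..
qed

lemma pinv_left_inverse:
  fixes M :: "real^'m^'k"
  assumes inj: "inj ((*v) M)"
  shows "pinv M ** M = mat 1"
proof -
  obtain B where "penrose M B"
    using ex_penrose_of_inj[OF inj] ..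
  then have "penrose M (pinv M)"
    unfolding pinv_eq_The_penrose by (metis theI penrose_unique[OF inj])
  then show ?thesis
    by (rule penrose_left_inverse[OF inj])
qed

lemma inf_norm_row_le: "(\<Sum>j\<in>UNIV. \<bar>A $ i $ j\<bar>) \<le> inf_norm A"
  unfolding inf_norm_def by (rule Max_ge) auto

lemma inf_norm_nonneg: "0 \<le> inf_norm A"
  using inf_norm_row_le[of A undefined] by (meson order_trans sum_nonneg abs_ge_zero)

lemma abs_matrix_vector_mult_le_inf_norm:
  fixes A :: "real^'m^'k"
  assumes "\<And>j. \<bar>u $ j\<bar> \<le> W"
  shows "\<bar>(A *v u) $ i\<bar> \<le> inf_norm A * W"
proof -
  have "\<bar>(A *v u) $ i\<bar> \<le> (\<Sum>j\<in>UNIV. \<bar>A $ i $ j * u $ j\<bar>)"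
    unfolding matrix_vector_mult_def by (simp add: sum_abs)
  also have "\<dots> \<le> (\<Sum>j\<in>UNIV. \<bar>A $ i $ j\<bar>) * W"
    unfolding sum_distrib_right
    by (rule sum_mono) (simp add: abs_mult assms mult_left_mono)
  also have "\<dots> \<le> inf_norm A * W"
    using inf_norm_row_le[of A i] assms[of undefined] by (intro mult_right_mono) auto
  finally show ?thesis .
qed

lemma norm_le_sqrt_card_mult:
  fixes v :: "real^'n"
  assumes "\<And>j. \<bar>v $ j\<bar> \<le> K"
  shows "norm v \<le> sqrt (real CARD('n)) * K"
proof -
  have "infnorm v \<le> K"
    unfolding infnorm_cart using assms by (intro cSup_least) auto
  then show ?thesis
    using norm_le_infnorm[of v] by (simp add: mult_left_mono order_trans)
qed

definition outer_sum :: "('p::finite \<Rightarrow> real) \<Rightarrow> ('p \<Rightarrow> real^'n) \<Rightarrow> real^'n^'n" where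
  "outer_sum w a = (\<chi> r s. \<Sum>j\<in>UNIV. w j * (a j $ r * a j $ s))"

lemma transpose_outer_sum: "transpose (outer_sum w a) = outer_sum w a"
  by (simp add: outer_sum_def transpose_def vec_eq_iff mult.commute)

lemma outer_sum_mult_vector:
  "outer_sum w a *v v = (\<Sum>j\<in>UNIV. (w j * inner (a j) v) *\<^sub>R a j)"
proof -
  have "(outer_sum w a *v v) $ r = (\<Sum>s\<in>UNIV. \<Sum>j\<in>UNIV. w j * (a j $ r * a j $ s) * v $ s)" for r
    by (simp add: outer_sum_def matrix_vector_mult_def sum_distrib_right)
  also have "\<dots> r = (\<Sum>j\<in>UNIV. \<Sum>s\<in>UNIV. w j * (a j $ r * a j $ s) * v $ s)" for r
    by (rule sum.swap)
  also have "\<dots> r = (\<Sum>j\<in>UNIV. (w j * inner (a j) v) *\<^sub>R a j) $ r" for r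
    by (simp add: sum_component inner_vec_def sum_distrib_left mult_ac)
  finally show ?thesis
    by (simp add: vec_eq_iff)
qed

lemma inner_outer_sum: "inner (outer_sum w a) D = (\<Sum>j\<in>UNIV. w j * inner (a j) (D *v a j))"
proof -
  have "inner (outer_sum w a) D = (\<Sum>r\<in>UNIV. \<Sum>s\<in>UNIV. \<Sum>j\<in>UNIV. w j * (a j $ r * a j $ s) * D $ r $ s)"
    by (simp add: outer_sum_def inner_vec_def sum_distrib_right)
  also have "\<dots> = (\<Sum>r\<in>UNIV. \<Sum>j\<in>UNIV. \<Sum>s\<in>UNIV. w j * (a j $ r * a j $ s) * D $ r $ s)"
    by (rule sum.cong[OF refl], rule sum.swap)
  also have "\<dots> = (\<Sum>j\<in>UNIV. \<Sum>r\<in>UNIV. \<Sum>s\<in>UNIV. w j * (a j $ r * a j $ s) * D $ r $ s)"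
    by (rule sum.swap)
  also have "\<dots> = (\<Sum>j\<in>UNIV. w j * inner (a j) (D *v a j))"
    by (simp add: inner_vec_def matrix_vector_mult_def sum_distrib_left mult_ac)
  finally show ?thesis .
qed

lemma onorm_outer_sum_le:
  fixes a :: "'p::finite \<Rightarrow> real^'n"
  assumes w: "\<And>j. \<bar>w j\<bar> \<le> W" and a: "\<And>j. norm (a j) \<le> r"
  shows "onorm ((*v) (outer_sum w a)) \<le> real CARD('p) * W * r^2"
proof (rule onorm_le)
  have "0 \<le> W" "0 \<le> r"
    using w[of undefined] a[of undefined] by (meson abs_ge_zero norm_ge_zero order_trans)+
  fix v
  have "norm (outer_sum w a *v v) \<le> (\<Sum>j\<in>UNIV. norm ((w j * inner (a j) v) *\<^sub>R a j))"
    unfolding outer_sum_mult_vector by (rule norm_sum)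
  also have "\<dots> \<le> (\<Sum>j\<in>(UNIV::'p set). W * r^2 * norm v)"
  proof (rule sum_mono)
    fix j
    have "norm ((w j * inner (a j) v) *\<^sub>R a j) \<le> \<bar>w j\<bar> * (norm (a j) * norm v) * norm (a j)"
      by (simp add: abs_mult mult_left_mono mult_right_mono Cauchy_Schwarz_ineq2)
    also have "\<dots> \<le> W * (r * norm v) * r"
      using w[of j] a[of j] \<open>0 \<le> W\<close> \<open>0 \<le> r\<close> by (intro mult_mono) auto
    finally show "norm ((w j * inner (a j) v) *\<^sub>R a j) \<le> W * r^2 * norm v"
      by (simp add: power2_eq_square mult_ac)
  qed
  finally show "norm (outer_sum w a *v v) \<le> real CARD('p) * W * r^2 * norm v"
    by simp
qed

lemma qval_add_affine: "qval (c + c0) (g + g0) H x z = qval c g H x z + c0 + inner g0 (z - x)"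
  by (simp add: qval_def inner_add_left)

lemma is_mfn_interp_hessian_eq_outer_sum:
  assumes mfn: "is_mfn_interp x y v c g H"
    and w_sum: "(\<Sum>i\<in>UNIV. w i) = 0"
    and w_moment: "(\<Sum>i\<in>UNIV. w i *\<^sub>R (y i - x)) = 0"
    and interp: "\<And>i. qval c' g' (outer_sum w (\<lambda>i. y i - x)) x (y i) = v i"
  shows "H = outer_sum w (\<lambda>i. y i - x)"
proof -
  define Hs where "Hs = outer_sum w (\<lambda>i. y i - x)"
  have H_interp: "\<And>i. qval c g H x (y i) = v i"
    and H_min: "norm H ^ 2 \<le> norm Hs ^ 2"
  proof -
    have "transpose Hs = Hs" "\<And>i. qval c' g' Hs x (y i) = v i"
      unfolding Hs_def using interp transpose_outer_sum by blast+
    then have "(1/4) * norm H ^ 2 \<le> (1/4) * norm Hs ^ 2"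
      using mfn unfolding is_mfn_interp_def by blast
    then show "norm H ^ 2 \<le> norm Hs ^ 2"
      by simp
    show "\<And>i. qval c g H x (y i) = v i"
      using mfn unfolding is_mfn_interp_def by blast
  qed
  define D where "D = H - Hs"
  have D_quad: "inner (y i - x) (D *v (y i - x)) = -2 * ((c - c') + inner (g - g') (y i - x))" for i
    using H_interp[of i] interp[of i]
    by (simp add: qval_def D_def Hs_def matrix_vector_mult_diff_rdistrib
        inner_diff_left inner_diff_right algebra_simps)
  \<comment> \<open>The quadratic form of D is affine on the points, and w annihilates affine functions there.\<close>
  have "inner Hs D = (\<Sum>i\<in>UNIV. w i * (-2 * ((c - c') + inner (g - g') (y i - x))))"
    unfolding Hs_def inner_outer_sum D_quad ..
  also have "\<dots> = (\<Sum>i\<in>UNIV. -2 * (c - c') * w i + -2 * inner (g - g') (w i *\<^sub>R (y i - x)))"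
    by (rule sum.cong) (simp_all add: algebra_simps)
  also have "\<dots> = -2 * (c - c') * (\<Sum>i\<in>UNIV. w i) + -2 * inner (g - g') (\<Sum>i\<in>UNIV. w i *\<^sub>R (y i - x))"
    by (simp only: sum.distrib sum_distrib_left inner_sum_right)
  finally have "inner Hs D = 0"
    using w_sum w_moment by simp
  then have "norm H ^ 2 = norm Hs ^ 2 + norm D ^ 2"
    unfolding D_def by (simp add: power2_norm_eq_inner inner_diff_left inner_diff_right inner_commute)
  then have "D = 0"
    using H_min by simp
  then show ?thesis
    unfolding D_def Hs_def by simp
qed

lemma sum_UNIV_Plus:
  "(\<Sum>b\<in>(UNIV::('a::finite + 'b::finite) set). h b) = (\<Sum>i\<in>UNIV. h (Inl i)) + (\<Sum>j\<in>UNIV. h (Inr j))"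
  using sum.Plus[of "UNIV::'a set" "UNIV::'b set" h] by (simp add: o_def)

lemma Fhat_solution_interpolates:
  fixes sol :: "real^('p::finite + (unit + 'n::finite))"
  assumes \<Delta>: "\<Delta> \<noteq> 0"
    and sol: "Fhat x \<Delta> y *v sol = (\<chi> b. case b of Inl i \<Rightarrow> v i | Inr _ \<Rightarrow> 0)"
  defines "w \<equiv> \<lambda>i. sol $ Inl i / \<Delta>^4"
  shows "(\<Sum>i\<in>UNIV. w i) = 0"
    and "(\<Sum>i\<in>UNIV. w i *\<^sub>R (y i - x)) = 0"
    and "qval (sol $ Inr (Inl ())) (\<chi> k. sol $ Inr (Inr k) / \<Delta>) (outer_sum w (\<lambda>i. y i - x)) x (y i) = v i"
proof -
  define a where "a i = y i - x" for i
  define lam where "lam i = sol $ Inl i" for i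
  have row: "(\<Sum>b\<in>UNIV. Fhat x \<Delta> y $ r $ b * sol $ b) = (case r of Inl i \<Rightarrow> v i | Inr _ \<Rightarrow> 0)" for r
    using sol by (simp add: matrix_vector_mult_def vec_eq_iff)
  have shat: "shat x \<Delta> y i $ k = a i $ k / \<Delta>" for i k
    by (simp add: shat_def a_def divide_inverse mult.commute)
  have "(\<Sum>i\<in>UNIV. lam i) = 0"
    using row[of "Inr (Inl ())"] by (simp add: Fhat_def Mhat_def sum_UNIV_Plus lam_def)
  then show "(\<Sum>i\<in>UNIV. w i) = 0"
    by (simp add: w_def lam_def flip: sum_divide_distrib)
  have "(\<Sum>i\<in>UNIV. lam i *\<^sub>R a i) $ k = 0" for k
  proof -
    have "(\<Sum>i\<in>UNIV. a i $ k / \<Delta> * lam i) = 0"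
      using row[of "Inr (Inr k)"] by (simp add: Fhat_def Mhat_def sum_UNIV_Plus lam_def shat)
    then have "\<Delta> * (\<Sum>i\<in>UNIV. a i $ k / \<Delta> * lam i) = 0"
      by simp
    then show ?thesis
      using \<Delta> by (simp add: sum_distrib_left sum_component mult_ac)
  qed
  then have "(\<Sum>i\<in>UNIV. lam i *\<^sub>R a i) = 0"
    by (simp add: vec_eq_iff)
  then have "(1 / \<Delta>^4) *\<^sub>R (\<Sum>i\<in>UNIV. lam i *\<^sub>R a i) = 0"
    by simp
  then show "(\<Sum>i\<in>UNIV. w i *\<^sub>R (y i - x)) = 0"
    by (simp add: scaleR_sum_right w_def lam_def a_def)
  have "(\<Sum>j\<in>UNIV. (inner (a i) (a j))^2 / (2 * \<Delta>^4) * lam j) + sol $ Inr (Inl ())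
      + inner (a i) (\<chi> k. sol $ Inr (Inr k) / \<Delta>) = v i"
  proof -
    have "inner (shat x \<Delta> y i) (shat x \<Delta> y j) = inner (a i) (a j) / \<Delta>^2" for j
      by (simp add: shat_def a_def power2_eq_square divide_inverse)
    then have "Phat x \<Delta> y $ i $ j = (inner (a i) (a j))^2 / (2 * \<Delta>^4)" for j
      by (simp add: Phat_def power_divide)
    moreover have "(\<Sum>k\<in>UNIV. shat x \<Delta> y i $ k * sol $ Inr (Inr k)) = inner (a i) (\<chi> k. sol $ Inr (Inr k) / \<Delta>)"
      by (simp add: shat inner_vec_def)
    ultimately show ?thesis
      using row[of "Inl i"] by (simp add: Fhat_def Mhat_def sum_UNIV_Plus lam_def UNIV_unit)
  qed
  moreover have "1/2 * inner (a i) (outer_sum w a *v a i)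
      = (\<Sum>j\<in>UNIV. (inner (a i) (a j))^2 / (2 * \<Delta>^4) * lam j)"
    unfolding outer_sum_mult_vector inner_sum_right sum_distrib_left
    by (rule sum.cong) (simp_all add: w_def lam_def power2_eq_square inner_commute)
  ultimately show "qval (sol $ Inr (Inl ())) (\<chi> k. sol $ Inr (Inr k) / \<Delta>) (outer_sum w (\<lambda>i. y i - x)) x (y i) = v i"
    unfolding qval_def a_def by (simp add: inner_commute)
qed

text \<open>Subtracting an affine function c0 + g0 (y - x) from the data changes only the affine part of an
  interpolant, so the minimum Frobenius norm Hessian can be read off the F-hat system for shifted data.\<close>
lemma is_mfn_interp_hessian_from_Fhat:
  fixes sol :: "real^('p::finite + (unit + 'n::finite))"
  assumes \<Delta>: "\<Delta> \<noteq> 0"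
    and mfn: "is_mfn_interp x y v c g H"
    and sol: "Fhat x \<Delta> y *v sol = (\<chi> b. case b of Inl i \<Rightarrow> v i - c0 - inner g0 (y i - x) | Inr _ \<Rightarrow> 0)"
  shows "H = outer_sum (\<lambda>i. sol $ Inl i / \<Delta>^4) (\<lambda>i. y i - x)"
proof (rule is_mfn_interp_hessian_eq_outer_sum[OF mfn])
  note shifted = Fhat_solution_interpolates[OF \<Delta> sol]
  show "(\<Sum>i\<in>UNIV. sol $ Inl i / \<Delta>^4) = 0"
    and "(\<Sum>i\<in>UNIV. (sol $ Inl i / \<Delta>^4) *\<^sub>R (y i - x)) = 0"
    by (fact shifted(1,2))+
  show "qval (sol $ Inr (Inl ()) + c0) ((\<chi> k. sol $ Inr (Inr k) / \<Delta>) + g0)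
      (outer_sum (\<lambda>i. sol $ Inl i / \<Delta>^4) (\<lambda>i. y i - x)) x (y i) = v i" for i
    using shifted(3)[of i] by (simp add: qval_add_affine)
qed

lemma inj_Mhat:
  fixes y :: "'p::finite \<Rightarrow> real^'n"
  assumes "invertible (Fhat x \<Delta> y)"
  shows "inj ((*v) (Mhat x \<Delta> y))"
proof (rule linear_injective_0[THEN iffD2, rule_format])
  fix z assume Mz: "Mhat x \<Delta> y *v z = 0"
  define e :: "real^('p + (unit + 'n))" where "e = (\<chi> b. case b of Inl _ \<Rightarrow> 0 | Inr k \<Rightarrow> z $ k)"
  have "(Fhat x \<Delta> y *v e) $ r = 0" for r
  proof (cases r)
    case (Inl i)
    then show ?thesis
      using Mz by (simp add: matrix_vector_mult_def Fhat_def e_def sum_UNIV_Plus vec_eq_iff)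
  qed (simp add: matrix_vector_mult_def Fhat_def e_def sum_UNIV_Plus)
  then have "Fhat x \<Delta> y *v e = Fhat x \<Delta> y *v 0"
    by (simp add: vec_eq_iff)
  then have "e = 0"
    by (rule injD[OF inj_matrix_vector_mult[OF assms]])
  then show "z = 0"
    by (simp add: vec_eq_iff e_def) (metis sum.case(2))
qed simp

lemma Mhat_mult_affine_coeffs:
  assumes "\<Delta> \<noteq> 0"
  shows "Mhat x \<Delta> y *v (\<chi> k. case k of Inl _ \<Rightarrow> c | Inr j \<Rightarrow> \<Delta> * g $ j) = (\<chi> i. c + inner g (y i - x))"
  using assms
  by (auto simp: vec_eq_iff matrix_vector_mult_def Mhat_def shat_def sum_UNIV_Plus UNIV_unit inner_vec_def
      intro!: sum.cong)

lemma affine_coeffs_bound: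
  fixes g :: "real^'n"
  assumes inj: "inj ((*v) (Mhat x \<Delta> y))" and \<Delta>: "\<Delta> > 0"
    and residual: "\<And>i. \<bar>c + inner g (y i - x)\<bar> \<le> W"
  shows "\<bar>c\<bar> \<le> inf_norm (pinv (Mhat x \<Delta> y)) * W"
    and "norm g \<le> sqrt (real CARD('n)) * (inf_norm (pinv (Mhat x \<Delta> y)) * W / \<Delta>)"
proof -
  define z :: "real^(unit + 'n)" where "z = (\<chi> k. case k of Inl _ \<Rightarrow> c | Inr j \<Rightarrow> \<Delta> * g $ j)"
  have "z = pinv (Mhat x \<Delta> y) *v (\<chi> i. c + inner g (y i - x))"
    unfolding Mhat_mult_affine_coeffs[OF less_imp_neq[OF \<Delta>, symmetric], symmetric] z_def
    by (simp add: matrix_vector_mul_assoc pinv_left_inverse[OF inj])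
  then have z_bound: "\<bar>z $ k\<bar> \<le> inf_norm (pinv (Mhat x \<Delta> y)) * W" for k
    using residual by (simp add: abs_matrix_vector_mult_le_inf_norm)
  show "\<bar>c\<bar> \<le> inf_norm (pinv (Mhat x \<Delta> y)) * W"
    using z_bound[of "Inl ()"] by (simp add: z_def)
  show "norm g \<le> sqrt (real CARD('n)) * (inf_norm (pinv (Mhat x \<Delta> y)) * W / \<Delta>)"
  proof (rule norm_le_sqrt_card_mult)
    fix j
    have "\<Delta> * \<bar>g $ j\<bar> \<le> inf_norm (pinv (Mhat x \<Delta> y)) * W"
      using z_bound[of "Inr j"] \<Delta> by (simp add: z_def abs_mult)
    then show "\<bar>g $ j\<bar> \<le> inf_norm (pinv (Mhat x \<Delta> y)) * W / \<Delta>"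
      using \<Delta> by (simp add: pos_le_divide_eq mult.commute)
  qed
qed

lemma quadratic_model_value_error:
  fixes f :: "real^'n \<Rightarrow> real"
  assumes grad: "\<And>z. GDERIV f z :> gf z" and lip: "L-lipschitz_on UNIV gf"
    and H: "onorm ((*v) H) \<le> \<kappa>" and z: "norm (z - x) \<le> \<Delta>"
  shows "\<bar>qval c g H x z - f z\<bar> \<le> \<bar>c - f x\<bar> + norm (g - gf x) * \<Delta> + (L + \<kappa>) / 2 * \<Delta>^2"
proof -
  have "\<bar>inner (g - gf x) (z - x)\<bar> \<le> norm (g - gf x) * \<Delta>"
    using z by (meson Cauchy_Schwarz_ineq2 mult_left_mono norm_ge_zero order_trans)
  moreover have "qval c g H x z - f z = (c - f x) + inner (g - gf x) (z - x)
      - (f z - f x - inner (gf x) (z - x) - 1/2 * inner (z - x) (H *v (z - x)))"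
    by (simp add: qval_def inner_diff_left)
  ultimately show ?thesis
    using lipschitz_gradient_quadratic_bound[OF grad lip H z] abs_ge_self[of "c - f x"]
      abs_ge_minus_self[of "c - f x"] by linarith
qed

lemma quadratic_model_gradient_error:
  fixes gf :: "real^'n \<Rightarrow> real^'n"
  assumes lip: "L-lipschitz_on UNIV gf"
    and H: "onorm ((*v) H) \<le> \<kappa>" and z: "norm (z - x) \<le> \<Delta>"
  shows "norm (g + H *v (z - x) - gf z) \<le> norm (g - gf x) + (\<kappa> + L) * \<Delta>"
proof -
  have "norm (H *v (z - x)) \<le> \<kappa> * \<Delta>"
    using onorm[of "(*v) H" "z - x"] H z
    by (meson mult_mono onorm_pos_le matrix_vector_mul_bounded_linear norm_ge_zero order_trans)
  moreover have "norm (gf z - gf x) \<le> L * \<Delta>"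
    using lipschitz_onD[OF lip, of z x] z lipschitz_on_nonneg[OF lip]
    by (simp add: dist_norm) (meson mult_left_mono order_trans)
  moreover have "norm (g + H *v (z - x) - gf z) \<le> norm (g - gf x) + norm (H *v (z - x)) + norm (gf z - gf x)"
    using norm_triangle_ineq4[of "(g - gf x) + H *v (z - x)" "gf z - gf x"]
      norm_triangle_ineq[of "g - gf x" "H *v (z - x)"] by (simp add: algebra_simps)
  ultimately show ?thesis
    by (simp add: distrib_right)
qed

lemma matrix_mul_matrix_inv:
  assumes "invertible A"
  shows "A ** matrix_inv A = mat 1"
  using assms unfolding invertible_def matrix_inv_def by (metis (mono_tags, lifting) someI_ex)

context
  fixes f ft :: "real^'n \<Rightarrow> real" and gf :: "real^'n \<Rightarrow> real^'n"
    and y :: "'p::finite \<Rightarrow> real^'n" and x :: "real^'n"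
    and c :: real and g :: "real^'n" and H :: "real^'n^'n"
    and L \<epsilon>f \<Delta> \<beta> :: real
  assumes grad: "\<And>z. GDERIV f z :> gf z"
    and lip: "L-lipschitz_on UNIV gf"
    and noise: "\<And>z. \<bar>ft z - f z\<bar> \<le> \<epsilon>f"
    and Delta_pos: "\<Delta> > 0"
    and points: "\<And>i. norm (y i - x) \<le> \<beta> * \<Delta>"
    and F_inv: "invertible (Fhat x \<Delta> y)"
    and mfn: "is_mfn_interp x y (\<lambda>i. ft (y i)) c g H"
begin

lemma model_hessian_bound:
  "onorm ((*v) H) \<le> L / 2 * real CARD('p) * \<beta>^4 * inf_norm (matrix_inv (Fhat x \<Delta> y))
     + \<epsilon>f / \<Delta>^2 * real CARD('p) * \<beta>^2 * inf_norm (matrix_inv (Fhat x \<Delta> y))"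
proof -
  define Fi where "Fi = inf_norm (matrix_inv (Fhat x \<Delta> y))"
  define V where "V = L / 2 * (\<beta> * \<Delta>)^2 + \<epsilon>f"
  define rhs :: "real^('p + (unit + 'n))"
    where "rhs = (\<chi> b. case b of Inl i \<Rightarrow> ft (y i) - f x - inner (gf x) (y i - x) | Inr _ \<Rightarrow> 0)"
  define sol where "sol = matrix_inv (Fhat x \<Delta> y) *v rhs"
  have "Fhat x \<Delta> y *v sol = rhs"
    by (simp add: sol_def matrix_vector_mul_assoc matrix_mul_matrix_inv[OF F_inv])
  then have H_eq: "H = outer_sum (\<lambda>i. sol $ Inl i / \<Delta>^4) (\<lambda>i. y i - x)"
    using is_mfn_interp_hessian_from_Fhat[OF _ mfn] Delta_pos unfolding rhs_def by simp
  have "\<bar>rhs $ b\<bar> \<le> V" for b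
  proof (cases b)
    case (Inl i)
    have "\<bar>f (y i) - f x - inner (gf x) (y i - x)\<bar> \<le> L / 2 * norm (y i - x)^2"
      by (rule lipschitz_gradient_taylor_bound[OF grad lip])
    also have "\<dots> \<le> L / 2 * (\<beta> * \<Delta>)^2"
      using points[of i] lipschitz_on_nonneg[OF lip] by (intro mult_left_mono power_mono) auto
    finally have "\<bar>f (y i) - f x - inner (gf x) (y i - x)\<bar> \<le> L / 2 * (\<beta> * \<Delta>)^2" .
    moreover have "rhs $ b = (ft (y i) - f (y i)) + (f (y i) - f x - inner (gf x) (y i - x))"
      using Inl by (simp add: rhs_def)
    ultimately show ?thesis
      using noise[of "y i"] unfolding V_def by linarith
  qed (use lipschitz_on_nonneg[OF lip] noise[of x] in \<open>simp add: rhs_def V_def\<close>)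
  then have "\<bar>sol $ Inl i / \<Delta>^4\<bar> \<le> Fi * V / \<Delta>^4" for i
    unfolding sol_def Fi_def using Delta_pos
    by (simp add: abs_matrix_vector_mult_le_inf_norm divide_right_mono)
  then have "onorm ((*v) H) \<le> real CARD('p) * (Fi * V / \<Delta>^4) * (\<beta> * \<Delta>)^2"
    unfolding H_eq using points by (rule onorm_outer_sum_le)
  also have "\<dots> = L / 2 * real CARD('p) * \<beta>^4 * Fi + \<epsilon>f / \<Delta>^2 * real CARD('p) * \<beta>^2 * Fi"
    using Delta_pos by (simp add: V_def field_simps power_mult_distrib)
  finally show ?thesis
    unfolding Fi_def .
qed

lemma model_affine_error_bound:
  assumes H: "onorm ((*v) H) \<le> \<kappa>"
  defines "W \<equiv> \<epsilon>f + (L + \<kappa>) / 2 * (\<beta> * \<Delta>)^2"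
  shows "\<bar>c - f x\<bar> \<le> inf_norm (pinv (Mhat x \<Delta> y)) * W"
    and "norm (g - gf x) \<le> sqrt (real CARD('n)) * (inf_norm (pinv (Mhat x \<Delta> y)) * W / \<Delta>)"
proof -
  have "\<bar>(c - f x) + inner (g - gf x) (y i - x)\<bar> \<le> W" for i
  proof -
    have "qval c g H x (y i) = ft (y i)"
      using mfn unfolding is_mfn_interp_def by blast
    then have "(c - f x) + inner (g - gf x) (y i - x)
        = (ft (y i) - f (y i)) + (f (y i) - f x - inner (gf x) (y i - x) - 1/2 * inner (y i - x) (H *v (y i - x)))"
      by (simp add: qval_def inner_diff_left)
    then show ?thesis
      using noise[of "y i"] lipschitz_gradient_quadratic_bound[OF grad lip H points[of i]]
      unfolding W_def by linarith
  qed
  then show "\<bar>c - f x\<bar> \<le> inf_norm (pinv (Mhat x \<Delta> y)) * W"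
    and "norm (g - gf x) \<le> sqrt (real CARD('n)) * (inf_norm (pinv (Mhat x \<Delta> y)) * W / \<Delta>)"
    using affine_coeffs_bound[OF inj_Mhat[OF F_inv] Delta_pos] by blast+
qed

lemma model_value_error_in_ball:
  assumes H: "onorm ((*v) H) \<le> \<kappa>" and z: "z \<in> cball x \<Delta>"
  shows "\<bar>qval c g H x z - f z\<bar> \<le>
    ((L + \<kappa>) / 2 * (1 + sqrt (real CARD('n))) * \<beta>^2 * inf_norm (pinv (Mhat x \<Delta> y)) + (L + \<kappa>) / 2) * \<Delta>^2
    + (1 + sqrt (real CARD('n))) * inf_norm (pinv (Mhat x \<Delta> y)) * \<epsilon>f"
proof -
  define Mi where "Mi = inf_norm (pinv (Mhat x \<Delta> y))"
  define s where "s = sqrt (real CARD('n))"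
  define W where "W = \<epsilon>f + (L + \<kappa>) / 2 * (\<beta> * \<Delta>)^2"
  have "\<bar>c - f x\<bar> \<le> Mi * W" and "norm (g - gf x) * \<Delta> \<le> s * Mi * W"
    using model_affine_error_bound[OF H] Delta_pos
    by (simp_all add: Mi_def s_def W_def pos_le_divide_eq mult_ac)
  moreover have "norm (z - x) \<le> \<Delta>"
    using z by (simp add: dist_norm norm_minus_commute)
  ultimately have "\<bar>qval c g H x z - f z\<bar> \<le> Mi * W + s * Mi * W + (L + \<kappa>) / 2 * \<Delta>^2"
    using quadratic_model_value_error[OF grad lip H, of z x \<Delta> c g] by linarith
  also have "\<dots> = ((L + \<kappa>) / 2 * (1 + s) * \<beta>^2 * Mi + (L + \<kappa>) / 2) * \<Delta>^2 + (1 + s) * Mi * \<epsilon>f"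
    by (simp add: W_def field_simps)
  finally show ?thesis
    unfolding Mi_def s_def .
qed

lemma model_gradient_error_in_ball:
  assumes H: "onorm ((*v) H) \<le> \<kappa>" and z: "z \<in> cball x \<Delta>"
  shows "norm (g + H *v (z - x) - gf z) \<le>
    (2 * ((L + \<kappa>) / 2 * (1 + sqrt (real CARD('n))) * \<beta>^2 * inf_norm (pinv (Mhat x \<Delta> y)) + (L + \<kappa>) / 2)
      + 2 * \<kappa>) * \<Delta>
    + 2 * ((1 + sqrt (real CARD('n))) * inf_norm (pinv (Mhat x \<Delta> y))) * \<epsilon>f / \<Delta>"
proof -
  define Mi where "Mi = inf_norm (pinv (Mhat x \<Delta> y))"
  define s where "s = sqrt (real CARD('n))"
  define A where "A = Mi * \<epsilon>f / \<Delta>"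
  define B where "B = (L + \<kappa>) * \<beta>^2 * Mi * \<Delta>"
  have "0 \<le> L" "0 \<le> \<epsilon>f" "0 \<le> Mi" "0 \<le> \<kappa>" "0 \<le> s"
    using lipschitz_on_nonneg[OF lip] noise[of x] onorm_pos_le[of "(*v) H"] H
    by (auto simp: Mi_def inf_norm_nonneg s_def)
  then have "0 \<le> A" "0 \<le> B" "0 \<le> s * A" "0 \<le> s * B" "0 \<le> \<kappa> * \<Delta>"
    using Delta_pos by (simp_all add: A_def B_def)
  moreover have "norm (g - gf x) \<le> s * A + s * B / 2"
    using model_affine_error_bound[OF H] Delta_pos
    by (simp add: Mi_def s_def A_def B_def field_simps power2_eq_square)
  moreover have "norm (z - x) \<le> \<Delta>"
    using z by (simp add: dist_norm norm_minus_commute)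
  moreover have "(2 * ((L + \<kappa>) / 2 * (1 + s) * \<beta>^2 * Mi + (L + \<kappa>) / 2) + 2 * \<kappa>) * \<Delta>
      + 2 * ((1 + s) * Mi) * \<epsilon>f / \<Delta>
      = B + s * B + (\<kappa> + L) * \<Delta> + 2 * (\<kappa> * \<Delta>) + 2 * A + 2 * (s * A)"
    using Delta_pos by (simp add: A_def B_def field_simps)
  ultimately show ?thesis
    using quadratic_model_gradient_error[OF lip H, of z x \<Delta> g]
    unfolding Mi_def s_def by argo
qed

end

theorem theorem8p4:
  fixes f ft :: "real^'n \<Rightarrow> real" and gf :: "real^'n \<Rightarrow> real^'n"
    and y :: "'p::finite \<Rightarrow> real^'n" and x :: "real^'n"
    and c :: real and g :: "real^'n" and H :: "real^'n^'n"
    and L \<epsilon>f \<Delta> \<beta> :: real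
  assumes p_lower: "CARD('n) + 2 \<le> CARD('p)"
    and p_upper: "CARD('p) \<le> (CARD('n) + 1) * (CARD('n) + 2) div 2 - 1"
    and bdd_below: "\<exists>b. \<forall>z. b \<le> f z"
    and grad: "\<And>z. GDERIV f z :> gf z"
    and grad_cont: "continuous_on UNIV gf"
    and lip: "L-lipschitz_on UNIV gf"
    and eps_pos: "\<epsilon>f > 0"
    and noise: "\<And>z. \<bar>ft z - f z\<bar> \<le> \<epsilon>f"
    and Delta_pos: "\<Delta> > 0"
    and beta_pos: "\<beta> > 0"
    and points: "\<And>i. norm (y i - x) \<le> \<beta> * \<Delta>"
    and F_inv: "invertible (Fhat x \<Delta> y)"
    and mfn: "is_mfn_interp x y (\<lambda>i. ft (y i)) c g H"
  shows "let Fi = inf_norm (matrix_inv (Fhat x \<Delta> y));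
             Mi = inf_norm (pinv (Mhat x \<Delta> y));
             nn = real CARD('n); pp = real CARD('p);
             \<kappa>H = L / 2 * pp * \<beta>^4 * Fi + \<epsilon>f / \<Delta>^2 * pp * \<beta>^2 * Fi;
             \<kappa>mf = (L + \<kappa>H) / 2 * (1 + sqrt nn) * \<beta>^2 * Mi + (L + \<kappa>H) / 2;
             \<kappa>mf' = (1 + sqrt nn) * Mi;
             \<kappa>mg = 2 * \<kappa>mf + 2 * \<kappa>H;
             \<kappa>mg' = 2 * \<kappa>mf'
         in onorm (\<lambda>v. H *v v) \<le> \<kappa>H \<and>
            (\<forall>z \<in> cball x \<Delta>.
               \<bar>qval c g H x z - f z\<bar> \<le> \<kappa>mf * \<Delta>^2 + \<kappa>mf' * \<epsilon>f \<and>
               norm ((g + H *v (z - x)) - gf z) \<le> \<kappa>mg * \<Delta> + \<kappa>mg' * \<epsilon>f / \<Delta>)"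
proof -
  define \<kappa>H where "\<kappa>H = L / 2 * real CARD('p) * \<beta>^4 * inf_norm (matrix_inv (Fhat x \<Delta> y))
    + \<epsilon>f / \<Delta>^2 * real CARD('p) * \<beta>^2 * inf_norm (matrix_inv (Fhat x \<Delta> y))"
  note setting = grad lip noise Delta_pos points F_inv mfn
  have hessian: "onorm ((*v) H) \<le> \<kappa>H"
    unfolding \<kappa>H_def by (rule model_hessian_bound[OF setting])
  show ?thesis
    unfolding Let_def \<kappa>H_def[symmetric]
    using hessian model_value_error_in_ball[OF setting hessian]
      model_gradient_error_in_ball[OF setting hessian]
    by blast
qed

end
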